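(* Let $q$ be a prime power and let $n,k$ be integers with $1\le k\le n-1$. Then $$\mathcal{C}_q(n,n-1,k)=\frac{q^{k+1}-1}{q-1}.$$
   Context: $\mathcal{G}_q(n,k)$ denotes the set of all $k$-dimensional subspaces of $\mathbb{F}_q^n$. For $0\le r\le k\le n$, a $q$-covering design $C_q[n,k,r]$ is a set $\mathbb{S}\subseteq\mathcal{G}_q(n,k)$ such that each element of $\mathcal{G}_q(n,r)$ is contained in at least one element of $\mathbb{S}$. The $q$-covering number $\mathcal{C}_q(n,k,r)$ is the minimum size of a $q$-covering design $C_q[n,k,r]$. *)

theory Defs
  imports "HOL-Analysis.Cartesian_Space" "HOL-Number_Theory.Prime_Powers"
begin

text \<open>
  The field \<open>\<bbbF>\<^sub>q\<close> is a finite field type \<open>'a\<close> with \<open>CARD('a) = q\<close>, and \<open>\<bbbF>\<^sub>q\<^sup>n\<close> is the type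
  \<open>'a ^ 'n\<close> with \<open>CARD('n) = n\<close>, so \<open>q\<close> and \<open>n\<close> are carried by the types. Subspaces and
  dimension are taken over \<open>'a\<close> (the \<open>vec\<close> interpretation), not over the reals.
\<close>

definition grassmannian :: "nat \<Rightarrow> ('a::{field,finite} ^ 'n::finite) set set" where
  "grassmannian k = {U. vec.subspace U \<and> vec.dim U = k}"

definition q_covering_design ::
    "nat \<Rightarrow> nat \<Rightarrow> ('a::{field,finite} ^ 'n::finite) set set \<Rightarrow> bool" where
  "q_covering_design k r S \<longleftrightarrow>
     S \<subseteq> grassmannian k \<and> (\<forall>T\<in>grassmannian r. \<exists>U\<in>S. T \<subseteq> U)"

text \<open>
  Meaningful for \<open>r \<le> k \<le> CARD('n)\<close>, where a covering design exists (for instance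
  \<open>grassmannian k\<close>). Every design is finite because \<open>'a ^ 'n\<close> is.
\<close>

definition q_covering_number ::
    "'a::{field,finite} itself \<Rightarrow> 'n::finite itself \<Rightarrow> nat \<Rightarrow> nat \<Rightarrow> nat" where
  "q_covering_number _ _ k r =
     (LEAST m. \<exists>S :: ('a ^ 'n) set set. q_covering_design k r S \<and> card S = m)"

end

theory Submission
  imports Defs
begin

text \<open>
  Hyperplanes of a space of dimension \<open>d\<close> are kernels of nonzero linear forms, and two forms have
  the same kernel iff they are proportional. Hence \<open>d\<close> independent forms give \<open>q ^ d - 1\<close> nonzero
  combinations and exactly \<open>(q ^ d - 1) / (q - 1)\<close> kernels (\<open>card_form_kernels\<close>). Both bounds rest
  on this count.

  Upper bound: take the kernels of all nonzero combinations of \<open>k + 1\<close> fixed coordinates. To vanish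
  on a \<open>k\<close>-dimensional subspace is to vanish on \<open>k\<close> vectors, which is \<open>k\<close> conditions on \<open>k + 1\<close>
  coefficients, so some nonzero combination does (\<open>ex_form_kernel_superset\<close>).

  Lower bound, in the spirit of Bose and Burton: suppose that \<open>S\<close> consists of fewer than
  \<open>(q ^ (k + 1) - 1) / (q - 1)\<close> proper subspaces. The whole space lies in no member of \<open>S\<close>. If a
  subspace \<open>U\<close> of dimension greater than \<open>k\<close> lies in no member of \<open>S\<close>, then each member contains
  at most one hyperplane of \<open>U\<close>, namely its own trace on \<open>U\<close>; but \<open>U\<close> has at least
  \<open>(q ^ (k + 1) - 1) / (q - 1)\<close> hyperplanes, so one of them lies in no member of \<open>S\<close>. Descending
  in this way ends at an uncovered subspace of dimension \<open>k\<close> (\<open>ex_uncovered_subspace\<close>).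
\<close>

section \<open>Linear forms and their kernels\<close>

text \<open>
  A linear form on the span of \<open>B\<close> is given by its values on \<open>B\<close>. Restricting the support of
  these values to a subset of \<open>B\<close> lets one definition serve both for all forms on a subspace and
  for the combinations of a few coordinates of the whole space.
\<close>

definition basis_form :: "('a::field ^ 'n) set \<Rightarrow> ('a ^ 'n \<Rightarrow> 'a) \<Rightarrow> 'a ^ 'n \<Rightarrow> 'a" where
  "basis_form B f x = (\<Sum>b\<in>B. f b * vec.representation B x b)"

definition form_kernel :: "('a::field ^ 'n) set \<Rightarrow> ('a ^ 'n \<Rightarrow> 'a) \<Rightarrow> ('a ^ 'n) set" where
  "form_kernel B f = {x \<in> vec.span B. basis_form B f x = 0}"

definition supported_on :: "'b set \<Rightarrow> ('b \<Rightarrow> 'a::zero) set" where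
  "supported_on C = {f. \<forall>b. b \<notin> C \<longrightarrow> f b = 0}"

lemma card_supported_on:
  fixes C :: "'b::finite set"
  shows "card (supported_on C :: ('b \<Rightarrow> 'a::{zero,finite}) set) = CARD('a) ^ card C"
proof -
  have "bij_betw (\<lambda>f. restrict f C) (supported_on C) (C \<rightarrow>\<^sub>E (UNIV :: 'a set))"
  proof (rule bij_betw_byWitness[where f' = "\<lambda>f b. if b \<in> C then f b else 0"])
  qed (auto simp: supported_on_def PiE_def extensional_def restrict_def fun_eq_iff)
  then show ?thesis
    by (simp add: bij_betw_same_card card_PiE)
qed

context
  fixes B :: "('a::{field,finite} ^ 'n::finite) set"
  assumes B: "vec.independent B"
begin

lemma basis_form_add:
  "x \<in> vec.span B \<Longrightarrow> y \<in> vec.span B \<Longrightarrow>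
    basis_form B f (x + y) = basis_form B f x + basis_form B f y"
  by (simp add: basis_form_def vec.representation_add[OF B] distrib_left sum.distrib)

lemma basis_form_scale:
  "x \<in> vec.span B \<Longrightarrow> basis_form B f (c *s x) = c * basis_form B f x"
  by (simp add: basis_form_def vec.representation_scale[OF B] sum_distrib_left mult_ac)

lemma basis_form_basis: "b \<in> B \<Longrightarrow> basis_form B f b = f b"
  by (simp add: basis_form_def vec.representation_basis[OF B] if_distrib cong: if_cong)

lemma subspace_form_kernel: "vec.subspace (form_kernel B f)"
proof (rule vec.subspaceI)
  show "0 \<in> form_kernel B f"
    by (simp add: form_kernel_def vec.span_zero basis_form_def vec.representation_zero)
qed (simp_all add: form_kernel_def vec.span_add vec.span_scale basis_form_add basis_form_scale)

text \<open>
  If \<open>z\<close> lies outside the kernel, every vector of the span is a multiple of \<open>z\<close> plus a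
  vector of the kernel.
\<close>

lemma form_kernel_decomposition:
  assumes "z \<in> vec.span B" "basis_form B f z \<noteq> 0" "x \<in> vec.span B"
  shows "x - (basis_form B f x / basis_form B f z) *s z \<in> form_kernel B f"
proof -
  let ?c = "basis_form B f x / basis_form B f z"
  have "basis_form B f (x + (- ?c) *s z) = 0"
    using assms by (simp only: basis_form_add basis_form_scale vec.span_scale) simp
  then show ?thesis
    using assms by (simp add: form_kernel_def vec.span_diff vec.span_scale)
qed

lemma dim_form_kernel:
  assumes "b \<in> B" "f b \<noteq> 0"
  shows "Suc (vec.dim (form_kernel B f)) = card B"
proof -
  let ?K = "form_kernel B f"
  have b: "b \<in> vec.span B" "basis_form B f b \<noteq> 0"
    using assms by (auto simp: basis_form_basis vec.span_base)
  have "vec.span (insert b ?K) = vec.span B"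
  proof
    show "vec.span (insert b ?K) \<subseteq> vec.span B"
      using b by (intro vec.span_minimal) (auto simp: form_kernel_def)
    show "vec.span B \<subseteq> vec.span (insert b ?K)"
    proof
      fix x assume "x \<in> vec.span B"
      from form_kernel_decomposition[OF b this] show "x \<in> vec.span (insert b ?K)"
        unfolding vec.span_insert by (auto intro: vec.span_base)
    qed
  qed
  then have "vec.dim (insert b ?K) = card B"
    by (metis B vec.dim_eq_card vec.dim_span)
  moreover have "b \<notin> vec.span ?K"
    unfolding vec.span_eq_iff[THEN iffD2, OF subspace_form_kernel]
    using b by (simp add: form_kernel_def)
  ultimately show ?thesis
    by (simp add: vec.dim_insert)
qed

text \<open>
  At a basis vector \<open>z\<close> outside the common kernel, the ratio of the two forms is the factor of
  proportionality: the two sides then agree on the kernel and at \<open>z\<close>.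
\<close>

lemma form_kernel_eq_imp_proportional:
  assumes f: "f \<in> supported_on B" "f \<noteq> (\<lambda>_. 0)"
    and g: "g \<in> supported_on B" "g \<noteq> (\<lambda>_. 0)"
    and eq: "form_kernel B g = form_kernel B f"
  shows "\<exists>c. c \<noteq> 0 \<and> g = (\<lambda>b. c * f b)"
proof -
  obtain z where z: "z \<in> B" "f z \<noteq> 0"
    using f by (auto simp: supported_on_def fun_eq_iff)
  have zs: "z \<in> vec.span B" using z by (simp add: vec.span_base)
  have fz: "basis_form B f z = f z" and gz: "basis_form B g z = g z"
    using z by (simp_all add: basis_form_basis)
  have "z \<notin> form_kernel B g" unfolding eq using z fz by (simp add: form_kernel_def)
  then have gz0: "g z \<noteq> 0" using zs gz by (simp add: form_kernel_def)
  have "g b = g z / f z * f b" for b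
  proof (cases "b \<in> B")
    case True
    let ?y = "b - (f b / f z) *s z"
    have bs: "b \<in> vec.span B" using True by (simp add: vec.span_base)
    have "?y \<in> form_kernel B f"
      using form_kernel_decomposition[OF zs _ bs, of f] z(2)
      unfolding fz basis_form_basis[OF True] by blast
    then have "?y \<in> form_kernel B g"
      unfolding eq .
    then have y: "?y \<in> vec.span B" "basis_form B g ?y = 0"
      unfolding form_kernel_def by blast+
    have "basis_form B g (?y + (f b / f z) *s z) = f b / f z * g z"
      unfolding basis_form_add[OF y(1) vec.span_scale[OF zs]] basis_form_scale[OF zs] gz y(2)
      by simp
    then show ?thesis
      unfolding diff_add_cancel basis_form_basis[OF True] by (simp add: mult.commute)
  next
    case False
    then show ?thesis using f g by (simp add: supported_on_def)
  qed
  then have "g = (\<lambda>b. g z / f z * f b)" by (rule ext)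
  moreover have "g z / f z \<noteq> 0" using gz0 z(2) by simp
  ultimately show ?thesis by blast
qed

lemma card_form_kernels:
  assumes "C \<subseteq> B"
  shows "card (form_kernel B ` (supported_on C - {\<lambda>_. 0})) * (CARD('a) - 1)
    = CARD('a) ^ card C - 1"
proof -
  let ?F = "supported_on C - {\<lambda>_. 0} :: ('a ^ 'n \<Rightarrow> 'a) set"
  have CB: "supported_on C \<subseteq> (supported_on B :: ('a ^ 'n \<Rightarrow> 'a) set)"
    using assms by (auto simp: supported_on_def)
  \<comment> \<open>The forms with a given kernel are the nonzero multiples of any one of them.\<close>
  have fibre: "card {g \<in> ?F. form_kernel B g = form_kernel B f} = CARD('a) - 1" if f: "f \<in> ?F" for f
  proof -
    obtain z where z: "f z \<noteq> 0" using f by (auto simp: fun_eq_iff)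
    have scale: "form_kernel B (\<lambda>b. c * f b) = form_kernel B f" if "c \<noteq> 0" for c
      using that by (auto simp: form_kernel_def basis_form_def mult.assoc simp flip: sum_distrib_left)
    have "{g \<in> ?F. form_kernel B g = form_kernel B f} = (\<lambda>c b. c * f b) ` (UNIV - {0})"
    proof
      show "{g \<in> ?F. form_kernel B g = form_kernel B f} \<subseteq> (\<lambda>c b. c * f b) ` (UNIV - {0})"
      proof
        fix g assume "g \<in> {g \<in> ?F. form_kernel B g = form_kernel B f}"
        then have "\<exists>c. c \<noteq> 0 \<and> g = (\<lambda>b. c * f b)"
          using f CB by (intro form_kernel_eq_imp_proportional) auto
        then show "g \<in> (\<lambda>c b. c * f b) ` (UNIV - {0})"
          by blast
      qed
      show "(\<lambda>c b. c * f b) ` (UNIV - {0}) \<subseteq> {g \<in> ?F. form_kernel B g = form_kernel B f}"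
        using f z by (auto simp: scale supported_on_def fun_eq_iff)
    qed
    moreover have "inj_on (\<lambda>c b. c * f b) (UNIV - {0})"
      using z by (auto simp: inj_on_def fun_eq_iff)
    ultimately show ?thesis
      by (simp add: card_image card_Diff_singleton)
  qed
  have "card ?F = (\<Sum>K\<in>form_kernel B ` ?F. card {g \<in> ?F. form_kernel B g = K})"
    using sum.image_gen[of ?F "\<lambda>_. 1::nat" "form_kernel B"] by simp
  also have "\<dots> = (\<Sum>K\<in>form_kernel B ` ?F. CARD('a) - 1)"
    using fibre by (intro sum.cong) auto
  finally have "card ?F = card (form_kernel B ` ?F) * (CARD('a) - 1)"
    by simp
  moreover have "card ?F = CARD('a) ^ card C - 1"
    using card_supported_on[of C, where 'a = 'a]
    by (subst card_Diff_singleton) (auto simp: supported_on_def)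
  ultimately show ?thesis by simp
qed

text \<open>
  By the pigeonhole principle two forms agree on a basis of \<open>T\<close>, as there are more forms than
  possible values there; their difference vanishes on \<open>T\<close>.
\<close>

lemma ex_form_kernel_superset:
  assumes C: "C \<subseteq> B" and T: "T \<subseteq> vec.span B" and dim: "vec.dim T < card C"
  shows "\<exists>f \<in> supported_on C - {\<lambda>_. 0}. T \<subseteq> form_kernel B f"
proof -
  obtain D where D: "D \<subseteq> T" "vec.independent D" "T \<subseteq> vec.span D" "card D = vec.dim T"
    by (rule vec.basis_exists)
  let ?e = "\<lambda>f. restrict (basis_form B f) D"
  have "card (D \<rightarrow>\<^sub>E (UNIV :: 'a set)) = CARD('a) ^ vec.dim T"
    by (simp add: card_PiE D)
  also have "\<dots> < CARD('a) ^ card C"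
    using dim card_mono[of UNIV "{0, 1 :: 'a}"] by (intro power_strict_increasing) auto
  also have "\<dots> = card (supported_on C :: ('a ^ 'n \<Rightarrow> 'a) set)"
    by (simp add: card_supported_on)
  finally have "card (D \<rightarrow>\<^sub>E (UNIV :: 'a set)) < card (supported_on C :: ('a ^ 'n \<Rightarrow> 'a) set)" .
  moreover have "finite (D \<rightarrow>\<^sub>E (UNIV :: 'a set))"
    by (simp add: finite_PiE)
  moreover have "?e ` supported_on C \<subseteq> D \<rightarrow>\<^sub>E UNIV" by auto
  ultimately have "\<not> inj_on ?e (supported_on C)"
    by (meson card_inj_on_le not_less)
  then obtain f g where fg: "f \<in> supported_on C" "g \<in> supported_on C" "?e f = ?e g" "f \<noteq> g"
    by (auto simp: inj_on_def)
  let ?h = "\<lambda>b. f b - g b"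
  have "basis_form B ?h d = 0" if "d \<in> D" for d
  proof -
    have "basis_form B f d = basis_form B g d"
      using fg(3) that by (metis restrict_apply')
    then show ?thesis
      by (simp add: basis_form_def left_diff_distrib sum_subtractf)
  qed
  then have "D \<subseteq> form_kernel B ?h"
    using D T by (auto simp: form_kernel_def)
  then have "T \<subseteq> form_kernel B ?h"
    using D(3) vec.span_minimal[OF _ subspace_form_kernel] by blast
  moreover have "?h \<in> supported_on C - {\<lambda>_. 0}"
    using fg by (auto simp: supported_on_def fun_eq_iff)
  ultimately show ?thesis by blast
qed

end

section \<open>Few proper subspaces leave some subspace uncovered\<close>

text \<open>
  One step of the descent. A member of \<open>S\<close> containing a hyperplane \<open>K\<close> of \<open>U\<close> but not \<open>U\<close> meets
  \<open>U\<close> exactly in \<open>K\<close>, so if every hyperplane of \<open>U\<close> were contained in a member of \<open>S\<close>, there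
  would be at least as many members of \<open>S\<close> as hyperplanes of \<open>U\<close>.
\<close>

lemma ex_uncovered_hyperplane:
  fixes S :: "('a::{field,finite} ^ 'n::finite) set set"
  assumes S: "\<And>H. H \<in> S \<Longrightarrow> vec.subspace H"
    and U: "vec.subspace U" "vec.dim U = Suc j" "\<And>H. H \<in> S \<Longrightarrow> \<not> U \<subseteq> H"
    and card: "card S * (CARD('a) - 1) < CARD('a) ^ Suc j - 1"
  shows "\<exists>K. vec.subspace K \<and> vec.dim K = j \<and> (\<forall>H\<in>S. \<not> K \<subseteq> H)"
proof (rule ccontr)
  assume no: "\<not> ?thesis"
  obtain B where B: "B \<subseteq> U" "vec.independent B" "U \<subseteq> vec.span B" "card B = vec.dim U"
    by (rule vec.basis_exists)
  have span: "vec.span B = U"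
    using B U(1) vec.span_subspace by blast
  let ?K = "form_kernel B ` (supported_on B - {\<lambda>_. 0})"
  have "?K \<subseteq> (\<lambda>H. H \<inter> U) ` S"
  proof
    fix K assume "K \<in> ?K"
    then obtain f where K: "K = form_kernel B f" and f: "f \<in> supported_on B" "f \<noteq> (\<lambda>_. 0)"
      by blast
    obtain b where "b \<in> B" "f b \<noteq> 0"
      using f by (auto simp: supported_on_def fun_eq_iff)
    then have dim: "vec.dim (form_kernel B f) = j"
      using dim_form_kernel[OF B(2)] B(4) U(2) by fastforce
    with no subspace_form_kernel[OF B(2)] obtain H where H: "H \<in> S" "form_kernel B f \<subseteq> H"
      by blast
    have sub: "vec.subspace (H \<inter> U)"
      using S[OF H(1)] U(1) by (rule vec.subspace_inter)
    have "vec.dim (H \<inter> U) \<le> j"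
    proof (rule ccontr)
      assume "\<not> ?thesis"
      then have "H \<inter> U = U"
        using vec.subspace_dim_equal[OF sub U(1)] U(2) by simp
      then show False using U(3)[OF H(1)] by blast
    qed
    moreover have "form_kernel B f \<subseteq> H \<inter> U"
      using H span by (auto simp: form_kernel_def)
    ultimately have "form_kernel B f = H \<inter> U"
      using vec.subspace_dim_equal[OF subspace_form_kernel[OF B(2)] sub] dim by simp
    then show "K \<in> (\<lambda>H. H \<inter> U) ` S"
      using H(1) K by blast
  qed
  then have "card ?K \<le> card S"
    by (rule surj_card_le[rotated]) simp
  then have "card ?K * (CARD('a) - 1) \<le> card S * (CARD('a) - 1)"
    by (rule mult_le_mono1)
  then show False
    using card unfolding card_form_kernels[OF B(2) subset_refl] B(4) U(2) by linarith
qed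

lemma ex_uncovered_subspace:
  fixes S :: "('a::{field,finite} ^ 'n::finite) set set"
  assumes S: "\<And>H. H \<in> S \<Longrightarrow> vec.subspace H" "UNIV \<notin> S"
    and card: "card S * (CARD('a) - 1) < CARD('a) ^ Suc k - 1"
    and k: "k \<le> CARD('n)"
  shows "\<exists>T. vec.subspace T \<and> vec.dim T = k \<and> (\<forall>H\<in>S. \<not> T \<subseteq> H)"
  using k
proof (induction rule: inc_induct)
  case base
  have "\<forall>H\<in>S. \<not> UNIV \<subseteq> H"
    using S(2) by (metis top.extremum_uniqueI)
  then show ?case
    using vec_dim_card by (intro exI[of _ UNIV]) (simp only: vec.subspace_UNIV)
next
  case (step j)
  then obtain U where "vec.subspace U" "vec.dim U = Suc j" "\<And>H. H \<in> S \<Longrightarrow> \<not> U \<subseteq> H"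
    by blast
  moreover have "CARD('a) ^ Suc k \<le> CARD('a) ^ Suc j"
    using step by (intro power_increasing) auto
  then have "card S * (CARD('a) - 1) < CARD('a) ^ Suc j - 1"
    using card by linarith
  ultimately show ?case
    using S(1) by (intro ex_uncovered_hyperplane) auto
qed

section \<open>The covering number for hyperplanes\<close>

theorem corollary7:
  fixes q n k :: nat
  assumes "primepow q"
    and "CARD('a::{field,finite}) = q"
    and "CARD('n::finite) = n"
    and "1 \<le> k" and "k \<le> n - 1"
  shows "real (q_covering_number TYPE('a) TYPE('n) (n - 1) k) = (real q ^ (k + 1) - 1) / (real q - 1)"
proof -
  have q: "q > 1" using assms(1) by (rule primepow_gt_Suc_0[unfolded One_nat_def[symmetric]])
  let ?B = "cart_basis :: ('a ^ 'n) set"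
  have ind: "vec.independent ?B" and span: "vec.span ?B = UNIV" and cardB: "card ?B = n"
    using assms(3) by (simp_all add: independent_cart_basis span_cart_basis card_cart_basis)
  have "Suc k \<le> card ?B"
    using cardB assms(4,5) by linarith
  then obtain C where C: "C \<subseteq> ?B" "card C = Suc k"
    by (rule obtain_subset_with_card_n)
  define S where "S = form_kernel ?B ` (supported_on C - {\<lambda>_. 0})"
  have cardS: "card S * (q - 1) = q ^ Suc k - 1"
    using card_form_kernels[OF ind C(1)] C(2) assms(2) by (simp add: S_def)
  have design: "q_covering_design (n - 1) k S"
    unfolding q_covering_design_def
  proof
    show "S \<subseteq> grassmannian (n - 1)"
    proof
      fix H assume "H \<in> S"
      then obtain f where f: "f \<in> supported_on C" "f \<noteq> (\<lambda>_. 0)" "H = form_kernel ?B f"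
        by (auto simp: S_def)
      then obtain b where "b \<in> ?B" "f b \<noteq> 0"
        using C(1) by (auto simp: supported_on_def fun_eq_iff)
      then have "Suc (vec.dim H) = n"
        using dim_form_kernel[OF ind] f(3) cardB by metis
      then show "H \<in> grassmannian (n - 1)"
        using subspace_form_kernel[OF ind] f(3) by (auto simp: grassmannian_def)
    qed
    show "\<forall>T\<in>grassmannian k. \<exists>H\<in>S. T \<subseteq> H"
      using ex_form_kernel_superset[OF ind C(1)] C(2) span by (auto simp: S_def grassmannian_def)
  qed
  have minimal: "card S \<le> card S'" if S': "q_covering_design (n - 1) k S'"
    for S' :: "('a ^ 'n) set set"
  proof (rule ccontr)
    assume "\<not> ?thesis"
    then have "card S' * (q - 1) < card S * (q - 1)" using q by simp
    then have "card S' * (CARD('a) - 1) < CARD('a) ^ Suc k - 1"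
      unfolding cardS assms(2) .
    moreover have "UNIV \<notin> S'"
    proof
      assume "UNIV \<in> S'"
      then have "vec.dim (UNIV :: ('a ^ 'n) set) = n - 1"
        using S' by (auto simp: q_covering_design_def grassmannian_def)
      then show False using assms(3-5) unfolding vec_dim_card by linarith
    qed
    moreover have "vec.subspace H" if "H \<in> S'" for H
      using S' that by (auto simp: q_covering_design_def grassmannian_def)
    moreover have "k \<le> CARD('n)"
      using assms(3,5) by simp
    ultimately obtain T where "vec.subspace T" "vec.dim T = k" "\<forall>H\<in>S'. \<not> T \<subseteq> H"
      using ex_uncovered_subspace[of S' k] by blast
    then show False
      using S' by (auto simp: q_covering_design_def grassmannian_def)
  qed
  have "q_covering_number TYPE('a) TYPE('n) (n - 1) k = card S"
    unfolding q_covering_number_def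
    by (rule Least_equality) (use design minimal in auto)
  moreover have "real (card S) * (real q - 1) = real q ^ (k + 1) - 1"
  proof -
    have "real (card S * (q - 1)) = real (q ^ Suc k - 1)"
      by (simp only: cardS)
    then show ?thesis using q by (simp add: of_nat_diff)
  qed
  ultimately show ?thesis
    using q by (simp add: field_simps)
qed

end
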